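(* Let $\theta\in\mathbb{R}\setminus\mathbb{Q}$, let $(m,n)\in\mathbb{Z}^2$, and let $w=\mu U^mV^n$ with $\mu\in\mathbb{C}$, $|\mu|=1$. Let $p$ be an instanton solution of $p(\Delta p)-(\Delta p)p=0$. Then $\operatorname{Ad}w(p)=wpw^*$ is also an instanton solution.
   Context: For irrational $\theta$, $A_\theta$ is the universal $C^*$-algebra generated by two unitaries $U,V$ with $UV=e^{2\pi i\theta}VU$, and $A_\theta^\infty$ is the smooth dense subalgebra (elements $\sum a_{m,n}U^mV^n$ with rapidly decreasing coefficients). $\delta_1,\delta_2$ are the $*$-derivations of $A_\theta^\infty$ determined by $\delta_1(U)=2\pi iU$, $\delta_1(V)=0$, $\delta_2(U)=0$, $\delta_2(V)=2\pi iV$, and $\Delta=\delta_1^2+\delta_2^2$. $\operatorname{Ad}w$ is the inner automorphism $a\mapsto waw^*$. The equation $p(\Delta p)-(\Delta p)p=0$ for a projection $p$ (self-adjoint idempotent) in $A_\theta^\infty$ is the Euler-Lagrange equation of the functional $p\mapsto\tau(\delta_1(p)^2+\delta_2(p)^2)$, where $\tau$ is the canonical tracial state. Instanton solutions: Let $A=A_\theta^\infty$, $B=A_{-1/\theta}^\infty$, and let $\Xi=\mathcal{S}(\mathbb{R})$ (Schwartz space) be the smooth version of Rieffel's $A$-$B$ equivalence bimodule obtained by completing $C_c(\mathbb{R})$, with $A$-valued inner product ${}_A\langle\cdot,\cdot\rangle$ and $B$-valued inner product $\langle\cdot,\cdot\rangle_B$, and with $A$ identified with $\operatorname{End}_B(\Xi)$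 via left multiplication. If $\xi\in\Xi$ and $\langle\xi,\xi\rangle_B$ is invertible, the endomorphism $\xi\langle\xi,\xi\rangle_B^{-1}\langle\xi,\cdot\rangle_B$ corresponds to the projection $p={}_A\langle\xi\langle\xi,\xi\rangle_B^{-1},\xi\rangle\in A$. The Gaussians $\xi_\lambda(t)=Ce^{-\pi\theta t^2-2i\lambda t}$ ($\lambda\in\mathbb{C}$, $C$ a constant) are the solutions of $\frac{d\xi}{dt}+(2\pi\theta t+2i\lambda)\xi=0$, and for $\theta$ small enough $\langle\xi_\lambda,\xi_\lambda\rangle_B$ is invertible. An instanton solution is a projection $p$ obtained in this way from such a Gaussian $\xi_\lambda$; these satisfy the self-duality equation $\overline{\partial}(p)p=0$, where $\overline{\partial}=\frac12(\delta_1+i\delta_2)$. *)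

theory Defs
  imports "HOL-Analysis.Analysis" "HOL-Algebra.Module"
begin

text \<open>
  Conventions. An element \<open>\<Sum>a\<^sub>m\<^sub>n U\<^sup>m V\<^sup>n\<close> of the smooth noncommutative torus is its array of
  coefficients \<open>a :: int \<times> int \<Rightarrow> complex\<close>. For every real \<open>\<theta>\<close> the rapidly decreasing arrays
  with the operations below are (isomorphic to) the smooth subalgebra of the universal
  \<open>C\<^sup>*\<close>-algebra generated by unitaries \<open>U\<close>, \<open>V\<close> with \<open>UV = e\<^bsup>2\<pi>i\<theta>\<^esup> VU\<close>; the formulas for product and
  involution come from \<open>V\<^sup>l U\<^sup>k = e\<^bsup>-2\<pi>i\<theta>kl\<^esup> U\<^sup>k V\<^sup>l\<close>.
\<close>

definition rapidly_decreasing :: "(int \<times> int \<Rightarrow> complex) \<Rightarrow> bool" where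
  "rapidly_decreasing a \<longleftrightarrow>
     (\<forall>N::nat. bounded (range (\<lambda>(m, n). (1 + \<bar>of_int m\<bar> + \<bar>of_int n\<bar>) ^ N * a (m, n))))"

definition monomial :: "int \<Rightarrow> int \<Rightarrow> int \<times> int \<Rightarrow> complex" where
  "monomial m n = (\<lambda>x. if x = (m, n) then 1 else 0)"

definition torus_mult ::
  "real \<Rightarrow> (int \<times> int \<Rightarrow> complex) \<Rightarrow> (int \<times> int \<Rightarrow> complex) \<Rightarrow> int \<times> int \<Rightarrow> complex" where
  "torus_mult \<theta> a b = (\<lambda>(m, n).
     \<Sum>\<^sub>\<infinity>(k, l). cis (- 2 * pi * \<theta> * of_int (l * (m - k))) * a (k, l) * b (m - k, n - l))"

definition smooth_torus :: "real \<Rightarrow> (complex, int \<times> int \<Rightarrow> complex) module" where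
  "smooth_torus \<theta> = \<lparr>carrier = Collect rapidly_decreasing,
     mult = torus_mult \<theta>, one = monomial 0 0,
     zero = (\<lambda>x. 0), add = (\<lambda>a b x. a x + b x), smult = (\<lambda>c a x. c * a x)\<rparr>"

definition torus_star :: "real \<Rightarrow> (int \<times> int \<Rightarrow> complex) \<Rightarrow> int \<times> int \<Rightarrow> complex" where
  "torus_star \<theta> a = (\<lambda>(m, n). cis (- 2 * pi * \<theta> * of_int (m * n)) * cnj (a (- m, - n)))"

abbreviation torus_U :: "int \<times> int \<Rightarrow> complex" where "torus_U \<equiv> monomial 1 0"
abbreviation torus_V :: "int \<times> int \<Rightarrow> complex" where "torus_V \<equiv> monomial 0 1"

text \<open>
  By the Leibniz rule, the derivation with \<open>\<delta>\<^sub>1(U) = 2\<pi>iU\<close> and \<open>\<delta>\<^sub>1(V) = 0\<close> multiplies \<open>U\<^sup>m V\<^sup>n\<close> by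
  \<open>2\<pi>im\<close>, and the derivation with \<open>\<delta>\<^sub>2(U) = 0\<close> and \<open>\<delta>\<^sub>2(V) = 2\<pi>iV\<close> multiplies it by \<open>2\<pi>in\<close>.
\<close>

definition delta1 :: "(int \<times> int \<Rightarrow> complex) \<Rightarrow> int \<times> int \<Rightarrow> complex" where
  "delta1 a = (\<lambda>(m, n). 2 * of_real pi * \<i> * of_int m * a (m, n))"

definition delta2 :: "(int \<times> int \<Rightarrow> complex) \<Rightarrow> int \<times> int \<Rightarrow> complex" where
  "delta2 a = (\<lambda>(m, n). 2 * of_real pi * \<i> * of_int n * a (m, n))"

definition laplacian :: "real \<Rightarrow> (int \<times> int \<Rightarrow> complex) \<Rightarrow> int \<times> int \<Rightarrow> complex" where
  "laplacian \<theta> a = delta1 (delta1 a) \<oplus>\<^bsub>smooth_torus \<theta>\<^esub> delta2 (delta2 a)"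

definition torus_projection :: "real \<Rightarrow> (int \<times> int \<Rightarrow> complex) \<Rightarrow> bool" where
  "torus_projection \<theta> p \<longleftrightarrow>
     p \<in> carrier (smooth_torus \<theta>) \<and> torus_star \<theta> p = p \<and> p \<otimes>\<^bsub>smooth_torus \<theta>\<^esub> p = p"

definition euler_lagrange :: "real \<Rightarrow> (int \<times> int \<Rightarrow> complex) \<Rightarrow> bool" where
  "euler_lagrange \<theta> p \<longleftrightarrow>
     p \<otimes>\<^bsub>smooth_torus \<theta>\<^esub> laplacian \<theta> p \<ominus>\<^bsub>smooth_torus \<theta>\<^esub> laplacian \<theta> p \<otimes>\<^bsub>smooth_torus \<theta>\<^esub> p
       = \<zero>\<^bsub>smooth_torus \<theta>\<^esub>"

definition Ad ::
  "real \<Rightarrow> (int \<times> int \<Rightarrow> complex) \<Rightarrow> (int \<times> int \<Rightarrow> complex) \<Rightarrow> int \<times> int \<Rightarrow> complex" where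
  "Ad \<theta> w a = w \<otimes>\<^bsub>smooth_torus \<theta>\<^esub> a \<otimes>\<^bsub>smooth_torus \<theta>\<^esub> torus_star \<theta> w"

definition schwartz :: "(real \<Rightarrow> complex) set" where
  "schwartz = {f. \<exists>D :: nat \<Rightarrow> real \<Rightarrow> complex. D 0 = f \<and>
     (\<forall>j t. (D j has_vector_derivative D (Suc j) t) (at t)) \<and>
     (\<forall>j k. bounded (range (\<lambda>t. of_real t ^ k * D j t)))}"

text \<open>
  The bimodule structure on the Schwartz space: the left action of \<open>A = A\<^sub>\<theta>\<close> is generated by
  \<open>(U\<xi>)(t) = \<xi>(t + 1)\<close> and \<open>(V\<xi>)(t) = e\<^bsup>2\<pi>i\<theta>t\<^esup> \<xi>(t)\<close>, the right action of \<open>B = A\<^bsub>-1/\<theta>\<^esub>\<close> by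
  \<open>(\<xi>U)(t) = \<xi>(t + 1/\<theta>)\<close> and \<open>(\<xi>V)(t) = e\<^bsup>2\<pi>it\<^esup> \<xi>(t)\<close>. The two actions commute. In the following two
  definitions the monomial \<open>U\<^sup>m V\<^sup>n\<close> acts from the left, respectively from the right.
\<close>

definition left_monomial :: "real \<Rightarrow> int \<Rightarrow> int \<Rightarrow> (real \<Rightarrow> complex) \<Rightarrow> real \<Rightarrow> complex" where
  "left_monomial \<theta> m n \<xi> = (\<lambda>t. cis (2 * pi * \<theta> * of_int n * (t + of_int m)) * \<xi> (t + of_int m))"

definition right_monomial :: "real \<Rightarrow> (real \<Rightarrow> complex) \<Rightarrow> int \<Rightarrow> int \<Rightarrow> real \<Rightarrow> complex" where
  "right_monomial \<theta> \<xi> m n = (\<lambda>t. cis (2 * pi * of_int n * t) * \<xi> (t + of_int m / \<theta>))"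

definition right_act ::
  "real \<Rightarrow> (real \<Rightarrow> complex) \<Rightarrow> (int \<times> int \<Rightarrow> complex) \<Rightarrow> real \<Rightarrow> complex" where
  "right_act \<theta> \<xi> b = (\<lambda>t. \<Sum>\<^sub>\<infinity>(m, n). b (m, n) * right_monomial \<theta> \<xi> m n t)"

text \<open>
  Rieffel's inner products, given by their Fourier coefficients. The \<open>A\<close>-valued one is linear in
  the first argument, the \<open>B\<close>-valued one in the second. The factor \<open>\<bar>\<theta>\<bar>\<close> (normalised Haar measure
  of \<open>\<real>/\<theta>\<^sup>-\<^sup>1\<int>\<close>) is the one for which \<open>\<^sub>A\<langle>\<xi>,\<eta>\<rangle>\<zeta> = \<xi>\<langle>\<eta>,\<zeta>\<rangle>\<^sub>B\<close>, by Poisson summation.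
\<close>

definition A_inner :: "real \<Rightarrow> (real \<Rightarrow> complex) \<Rightarrow> (real \<Rightarrow> complex) \<Rightarrow> int \<times> int \<Rightarrow> complex" where
  "A_inner \<theta> \<xi> \<eta> = (\<lambda>(m, n).
     of_real \<bar>\<theta>\<bar> * (\<integral>t. \<xi> t * cnj (left_monomial \<theta> m n \<eta> t) \<partial>lborel))"

definition B_inner :: "real \<Rightarrow> (real \<Rightarrow> complex) \<Rightarrow> (real \<Rightarrow> complex) \<Rightarrow> int \<times> int \<Rightarrow> complex" where
  "B_inner \<theta> \<xi> \<eta> = (\<lambda>(m, n). \<integral>t. cnj (right_monomial \<theta> \<xi> m n t) * \<eta> t \<partial>lborel)"

definition gaussian :: "real \<Rightarrow> complex \<Rightarrow> complex \<Rightarrow> real \<Rightarrow> complex" where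
  "gaussian \<theta> C z = (\<lambda>t. C * exp (- of_real (pi * \<theta> * t\<^sup>2) - 2 * \<i> * z * of_real t))"

text \<open>
  The Gaussian is a Schwartz function only for \<open>\<theta> > 0\<close> (or \<open>C = 0\<close>, where the inner product is not
  invertible), so membership in the Schwartz space is a genuine requirement. Writing \<open>\<partial>\<close>-bar for
  \<open>(\<delta>\<^sub>1 + i\<delta>\<^sub>2)/2\<close>, the resulting projections satisfy the self-duality equation in the order
  \<open>p \<partial>\<close>-bar\<open>(p) = 0\<close>; no left action with \<open>UV = e\<^bsup>2\<pi>i\<theta>\<^esup> VU\<close> and these Gaussians gives the other order.
\<close>

definition instanton_solution :: "real \<Rightarrow> (int \<times> int \<Rightarrow> complex) \<Rightarrow> bool" where
  "instanton_solution \<theta> p \<longleftrightarrow> torus_projection \<theta> p \<and>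
     (\<exists>C z. let \<xi> = gaussian \<theta> C z; B = smooth_torus (- 1 / \<theta>) in
        \<xi> \<in> schwartz \<and> B_inner \<theta> \<xi> \<xi> \<in> Units B \<and>
        p = A_inner \<theta> (right_act \<theta> \<xi> (inv\<^bsub>B\<^esub> (B_inner \<theta> \<xi> \<xi>))) \<xi>)"

lemma monomial_mult:
  "monomial m n \<otimes>\<^bsub>smooth_torus \<theta>\<^esub> monomial k l =
     cis (- 2 * pi * \<theta> * of_int (n * k)) \<odot>\<^bsub>smooth_torus \<theta>\<^esub> monomial (m + k) (n + l)"
proof (rule ext, clarify)
  fix x y :: int
  have "(\<Sum>\<^sub>\<infinity>(i, j). cis (- 2 * pi * \<theta> * of_int (j * (x - i))) * monomial m n (i, j) *
            monomial k l (x - i, y - j))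
      = (\<Sum>\<^sub>\<infinity>(i, j)\<in>{(m, n)}. cis (- 2 * pi * \<theta> * of_int (j * (x - i))) * monomial m n (i, j) *
            monomial k l (x - i, y - j))"
    by (rule infsum_cong_neutral) (auto simp: monomial_def split: if_splits)
  then show "(monomial m n \<otimes>\<^bsub>smooth_torus \<theta>\<^esub> monomial k l) (x, y) =
     (cis (- 2 * pi * \<theta> * of_int (n * k)) \<odot>\<^bsub>smooth_torus \<theta>\<^esub> monomial (m + k) (n + l)) (x, y)"
    by (auto simp: smooth_torus_def torus_mult_def monomial_def)
qed

lemma torus_commutation:
  "torus_U \<otimes>\<^bsub>smooth_torus \<theta>\<^esub> torus_V =
     cis (2 * pi * \<theta>) \<odot>\<^bsub>smooth_torus \<theta>\<^esub> (torus_V \<otimes>\<^bsub>smooth_torus \<theta>\<^esub> torus_U)"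
  unfolding monomial_mult by (auto simp: smooth_torus_def mult.assoc[symmetric] cis_mult)

lemma delta_generators:
  "delta1 torus_U = (2 * of_real pi * \<i>) \<odot>\<^bsub>smooth_torus \<theta>\<^esub> torus_U"
  "delta1 torus_V = \<zero>\<^bsub>smooth_torus \<theta>\<^esub>"
  "delta2 torus_U = \<zero>\<^bsub>smooth_torus \<theta>\<^esub>"
  "delta2 torus_V = (2 * of_real pi * \<i>) \<odot>\<^bsub>smooth_torus \<theta>\<^esub> torus_V"
  by (auto simp: fun_eq_iff smooth_torus_def monomial_def delta1_def delta2_def)

end

theory Submission
  imports Defs
begin

text \<open>
  Conjugation by \<open>w = \<mu>U\<^sup>mV\<^sup>n\<close> multiplies \<open>U\<^sup>kV\<^sup>l\<close> by the phase \<open>e\<^bsup>2\<pi>i\<theta>(ml - nk)\<^esup>\<close> (\<open>Ad_monomial\<close>), so it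
  is one element of the dual action of the two-torus on the algebra. This action is by
  \<open>*\<close>-automorphisms, and, as it is diagonal in the basis \<open>U\<^sup>kV\<^sup>l\<close> just like \<open>\<delta>\<^sub>1\<close> and \<open>\<delta>\<^sub>2\<close>, it commutes
  with the Laplacian. Hence \<open>Ad w\<close> preserves projections and the Euler-Lagrange equation.

  To see that the new projection again comes from a Gaussian, let \<open>\<xi>\<close> be the Gaussian behind \<open>p\<close> and
  move it by the left action: \<open>\<xi>' = U\<^sup>mV\<^sup>n\<xi>\<close>. This is a translate of \<open>\<xi>\<close> times a character of the line,
  and both operations keep the quadratic coefficient of the exponent, so that \<open>\<xi>'\<close> is a Gaussian for
  the same \<open>\<theta>\<close> with other parameters \<open>C\<close> and \<open>z\<close>
  (\<open>left_monomial_gaussian\<close>). The rest is the bimodule calculus. The left action is unitary and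
  commutes with the right one, so \<open>\<langle>\<xi>',\<xi>'\<rangle>\<^sub>B = \<langle>\<xi>,\<xi>\<rangle>\<^sub>B\<close> (\<open>B_inner_left_monomial\<close>) and
  \<open>\<xi>'\<langle>\<xi>',\<xi>'\<rangle>\<^sub>B\<^sup>-\<^sup>1 = U\<^sup>mV\<^sup>n(\<xi>\<langle>\<xi>,\<xi>\<rangle>\<^sub>B\<^sup>-\<^sup>1)\<close> (\<open>right_act_left_monomial\<close>), while
  \<open>\<^sub>A\<langle>w\<xi>,w\<eta>\<rangle> = w \<^sub>A\<langle>\<xi>,\<eta>\<rangle> w\<^sup>*\<close> (\<open>A_inner_left_monomial\<close>). Together they say that \<open>wpw\<^sup>*\<close> is the
  projection built from \<open>\<xi>'\<close>.
\<close>

section \<open>The dual torus action\<close>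

definition dual_action ::
  "real \<Rightarrow> real \<Rightarrow> (int \<times> int \<Rightarrow> complex) \<Rightarrow> int \<times> int \<Rightarrow> complex" where
  "dual_action \<alpha> \<beta> a = (\<lambda>(k, l). cis (\<alpha> * of_int k + \<beta> * of_int l) * a (k, l))"

lemma cis_of_int_turns: "cis (2 * pi * of_int k) = 1"
  by (rule complex_eqI) (simp_all add: cos_int_2pin sin_int_2pin)

lemma cis_mult_left: "cis a * (cis b * z) = cis (a + b) * z"
  by (simp add: cis_mult flip: mult.assoc)

text \<open>
  A character of \<open>\<int>\<^sup>2\<close> takes the same value on every product of terms that contributes to a given
  coefficient of a twisted convolution, so it factors out of the sum.
\<close>

lemma dual_action_mult:
  "torus_mult \<theta> (dual_action \<alpha> \<beta> a) (dual_action \<alpha> \<beta> b) = dual_action \<alpha> \<beta> (torus_mult \<theta> a b)"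
proof (rule ext, clarify)
  fix m n :: int
  have "torus_mult \<theta> (dual_action \<alpha> \<beta> a) (dual_action \<alpha> \<beta> b) (m, n) =
      (\<Sum>\<^sub>\<infinity>(k, l). cis (\<alpha> * of_int m + \<beta> * of_int n) *
         (cis (- 2 * pi * \<theta> * of_int (l * (m - k))) * a (k, l) * b (m - k, n - l)))"
    unfolding torus_mult_def dual_action_def
    by (auto intro!: infsum_cong simp: cis_mult algebra_simps)
  also have "\<dots> = dual_action \<alpha> \<beta> (torus_mult \<theta> a b) (m, n)"
    by (simp add: torus_mult_def dual_action_def case_prod_unfold infsum_cmult_right')
  finally show "torus_mult \<theta> (dual_action \<alpha> \<beta> a) (dual_action \<alpha> \<beta> b) (m, n) =
      dual_action \<alpha> \<beta> (torus_mult \<theta> a b) (m, n)" .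
qed

lemma dual_action_star:
  "torus_star \<theta> (dual_action \<alpha> \<beta> a) = dual_action \<alpha> \<beta> (torus_star \<theta> a)"
  by (auto simp: torus_star_def dual_action_def cis_cnj algebra_simps fun_eq_iff)

lemma dual_action_laplacian:
  "laplacian \<theta> (dual_action \<alpha> \<beta> a) = dual_action \<alpha> \<beta> (laplacian \<theta> a)"
  by (auto simp: laplacian_def smooth_torus_def delta1_def delta2_def dual_action_def
      algebra_simps fun_eq_iff)

lemma rapidly_decreasing_iff:
  "rapidly_decreasing a \<longleftrightarrow>
    (\<forall>N. \<exists>C. \<forall>k l. (1 + \<bar>of_int k\<bar> + \<bar>of_int l\<bar>) ^ N * cmod (a (k, l)) \<le> C)"
proof -
  have *: "cmod (1 + \<bar>of_int k\<bar> + \<bar>of_int l\<bar>) = 1 + \<bar>of_int k\<bar> + \<bar>of_int l\<bar>" for k l :: int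
  proof -
    have "(1 + \<bar>of_int k\<bar> + \<bar>of_int l\<bar> :: complex) = of_real (1 + \<bar>of_int k\<bar> + \<bar>of_int l\<bar>)"
      by (simp add: abs_complex_def flip: of_int_abs)
    then show ?thesis by (simp only: norm_of_real)
  qed
  show ?thesis
    unfolding rapidly_decreasing_def bounded_iff
    by (simp add: norm_mult norm_power *)
qed

lemma dual_action_rapidly_decreasing:
  "rapidly_decreasing (dual_action \<alpha> \<beta> a) \<longleftrightarrow> rapidly_decreasing a"
  by (simp add: rapidly_decreasing_iff dual_action_def norm_mult)

lemma torus_projection_dual_action:
  assumes "torus_projection \<theta> p"
  shows "torus_projection \<theta> (dual_action \<alpha> \<beta> p)"
  using assms
  by (auto simp: torus_projection_def smooth_torus_def dual_action_rapidly_decreasing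
      dual_action_star dual_action_mult)

section \<open>Rapid decay of twisted convolutions\<close>

lemma summable_on_inverse_square_int:
  "(\<lambda>k::int. 1 / (1 + \<bar>of_int k\<bar>) ^ 2 :: real) summable_on UNIV"
proof -
  let ?f = "\<lambda>k::int. 1 / (1 + \<bar>of_int k\<bar>) ^ 2 :: real"
  have sum: "summable (\<lambda>n. inverse (real n ^ 2))"
    using inverse_power_summable[of 2, where 'a = real] by simp
  have "summable (\<lambda>n. 1 / (1 + real n) ^ 2)"
    using summable_ignore_initial_segment[OF sum, of 1] by (simp add: inverse_eq_divide add.commute)
  then have s: "(\<lambda>n. 1 / (1 + real n) ^ 2) summable_on UNIV"
    by (subst summable_on_UNIV_nonneg_real_iff) auto
  have 1: "?f summable_on range int"
    by (subst summable_on_reindex) (auto simp: o_def s inj_on_def)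
  have "summable (\<lambda>n. 1 / (2 + real n) ^ 2)"
    using summable_ignore_initial_segment[OF sum, of 2] by (simp add: inverse_eq_divide add.commute)
  then have "(\<lambda>n. 1 / (2 + real n) ^ 2) summable_on UNIV"
    by (subst summable_on_UNIV_nonneg_real_iff) auto
  then have 2: "?f summable_on range (\<lambda>n. - int (Suc n))"
    by (subst summable_on_reindex) (auto simp: o_def inj_on_def add.commute)
  have "k \<in> range int \<union> range (\<lambda>n. - int (Suc n))" for k
    by (cases k rule: int_cases) blast+
  then have "UNIV = range int \<union> range (\<lambda>n. - int (Suc n))" by blast
  moreover have "?f summable_on range int \<union> range (\<lambda>n. - int (Suc n))"
    by (rule summable_on_Un_disjoint[OF 1 2]) auto
  ultimately show ?thesis by simp
qed

text \<open>
  Spending four extra powers of the weight leaves the majorant \<open>(1 + |k|)\<^sup>-\<^sup>2(1 + |l|)\<^sup>-\<^sup>2\<close>, a product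
  of two summable functions of one integer.
\<close>

lemma rapidly_decreasing_weighted_summable:
  assumes "rapidly_decreasing a"
  shows "(\<lambda>(k, l). (1 + \<bar>of_int k\<bar> + \<bar>of_int l\<bar>) ^ N * cmod (a (k, l))) summable_on UNIV"
proof -
  let ?h = "\<lambda>k l::int. 1 + \<bar>of_int k\<bar> + \<bar>of_int l\<bar> :: real"
  let ?g = "\<lambda>k::int. 1 / (1 + \<bar>of_int k\<bar>) ^ 2 :: real"
  obtain C where C: "\<And>k l. ?h k l ^ (N + 4) * cmod (a (k, l)) \<le> C"
    using assms unfolding rapidly_decreasing_iff by blast
  have "(\<lambda>(k, l). ?g k * ?g l) summable_on UNIV \<times> UNIV"
  proof (rule summable_on_SigmaI[where g = "\<lambda>k. ?g k * infsum ?g UNIV"])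
    show "((\<lambda>l. case (k, l) of (k, l) \<Rightarrow> ?g k * ?g l) has_sum ?g k * infsum ?g UNIV) UNIV" for k
      unfolding prod.case
      by (intro has_sum_cmult_right has_sum_infsum summable_on_inverse_square_int)
    show "(\<lambda>k. ?g k * infsum ?g UNIV) summable_on UNIV"
      by (intro summable_on_cmult_left summable_on_inverse_square_int)
  qed auto
  then have "(\<lambda>(k, l). C * (?g k * ?g l)) summable_on UNIV"
    using summable_on_cmult_right[of "\<lambda>(k, l). ?g k * ?g l" UNIV C]
    by (simp add: case_prod_unfold)
  then show ?thesis
  proof (rule summable_on_comparison_test)
    fix x :: "int \<times> int"
    obtain k l where x: "x = (k, l)" by fastforce
    let ?d = "(1 + \<bar>of_int k\<bar>) ^ 2 * (1 + \<bar>of_int l\<bar>) ^ 2 :: real"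
    have "?d \<le> ?h k l ^ 2 * ?h k l ^ 2"
      by (intro mult_mono power_mono) auto
    then have "?d * (?h k l ^ N * cmod (a (k, l))) \<le> ?h k l ^ 4 * (?h k l ^ N * cmod (a (k, l)))"
      by (intro mult_right_mono) (auto simp: power_add[symmetric])
    also have "\<dots> \<le> C" using C[of k l] by (simp add: power_add mult_ac)
    finally have "?h k l ^ N * cmod (a (k, l)) \<le> C / ?d"
      by (subst pos_le_divide_eq) (auto intro!: mult_pos_pos zero_less_power add_pos_nonneg simp: mult.commute)
    then show "(case x of (k, l) \<Rightarrow> ?h k l ^ N * cmod (a (k, l))) \<le>
        (case x of (k, l) \<Rightarrow> C * (?g k * ?g l))"
      by (simp add: x)
  qed auto
qed

text \<open>
  The weight \<open>1 + |m| + |n|\<close> is submultiplicative on \<open>\<int>\<^sup>2\<close>, so it can be distributed over the two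
  factors of a convolution; one factor is then bounded and the other summable.
\<close>

lemma rapidly_decreasing_mult:
  assumes a: "rapidly_decreasing a" and b: "rapidly_decreasing b"
  shows "rapidly_decreasing (torus_mult \<theta> a b)"
  unfolding rapidly_decreasing_iff
proof
  fix N
  let ?h = "\<lambda>k l::int. 1 + \<bar>of_int k\<bar> + \<bar>of_int l\<bar> :: real"
  let ?A = "\<lambda>(k, l). ?h k l ^ N * cmod (a (k, l))"
  obtain C where C: "\<And>k l. ?h k l ^ N * cmod (b (k, l)) \<le> C"
    using b unfolding rapidly_decreasing_iff by blast
  have sA: "(\<lambda>x. ?A x * C) summable_on UNIV"
    by (intro summable_on_cmult_left rapidly_decreasing_weighted_summable a)
  have "?h m n ^ N * cmod (torus_mult \<theta> a b (m, n)) \<le> infsum (\<lambda>x. ?A x * C) UNIV" for m n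
  proof -
    let ?t = "\<lambda>(k, l). of_real (?h m n ^ N) *
      (cis (- 2 * pi * \<theta> * of_int (l * (m - k))) * a (k, l) * b (m - k, n - l))"
    have le: "cmod (?t x) \<le> ?A x * C" for x
    proof -
      obtain k l where x: "x = (k, l)" by fastforce
      have "?h m n \<le> ?h k l + \<bar>of_int (m - k)\<bar> + \<bar>of_int (n - l)\<bar>"
        by simp
      also have "\<dots> \<le> ?h k l * ?h (m - k) (n - l)"
        by (simp add: algebra_simps)
      finally have h: "?h m n ^ N \<le> ?h k l ^ N * ?h (m - k) (n - l) ^ N"
        unfolding power_mult_distrib[symmetric] by (rule power_mono) simp
      have "cmod (?t x) = ?h m n ^ N * (cmod (a (k, l)) * cmod (b (m - k, n - l)))"
        unfolding x prod.case norm_mult norm_of_real norm_cis by simp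
      also have "\<dots> \<le> (?h k l ^ N * ?h (m - k) (n - l) ^ N) *
          (cmod (a (k, l)) * cmod (b (m - k, n - l)))"
        by (rule mult_right_mono[OF h]) simp
      also have "\<dots> = ?A x * (?h (m - k) (n - l) ^ N * cmod (b (m - k, n - l)))"
        by (simp add: x)
      also have "\<dots> \<le> ?A x * C"
        by (rule mult_left_mono[OF C]) (simp add: x)
      finally show ?thesis .
    qed
    have s: "(\<lambda>x. cmod (?t x)) summable_on UNIV"
      by (rule summable_on_comparison_test[OF sA le norm_ge_zero])
    have "infsum ?t UNIV = of_real (?h m n ^ N) * torus_mult \<theta> a b (m, n)"
      by (simp add: torus_mult_def case_prod_unfold infsum_cmult_right' del: of_real_power)
    then have "?h m n ^ N * cmod (torus_mult \<theta> a b (m, n)) = cmod (infsum ?t UNIV)"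
      by (simp only: norm_mult norm_of_real) simp
    also have "\<dots> \<le> infsum (\<lambda>x. cmod (?t x)) UNIV"
      by (rule norm_infsum_bound) (use s in simp)
    also have "\<dots> \<le> infsum (\<lambda>x. ?A x * C) UNIV"
      by (rule infsum_mono[OF s sA le])
    finally show ?thesis .
  qed
  then show "\<exists>C. \<forall>k l. ?h k l ^ N * cmod (torus_mult \<theta> a b (k, l)) \<le> C" by blast
qed

lemma rapidly_decreasing_laplacian:
  assumes "rapidly_decreasing a"
  shows "rapidly_decreasing (laplacian \<theta> a)"
  unfolding rapidly_decreasing_iff
proof
  fix N
  let ?h = "\<lambda>k l::int. 1 + \<bar>of_int k\<bar> + \<bar>of_int l\<bar> :: real"
  obtain C where C: "\<And>k l. ?h k l ^ (N + 2) * cmod (a (k, l)) \<le> C"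
    using assms unfolding rapidly_decreasing_iff by blast
  have "?h k l ^ N * cmod (laplacian \<theta> a (k, l)) \<le> (2 * pi)\<^sup>2 * C" for k l
  proof -
    have "laplacian \<theta> a (k, l) = of_real (- ((2 * pi)\<^sup>2 * (of_int k ^ 2 + of_int l ^ 2))) * a (k, l)"
      by (simp add: laplacian_def smooth_torus_def delta1_def delta2_def power2_eq_square
          algebra_simps)
    then have "cmod (laplacian \<theta> a (k, l)) =
        (2 * pi)\<^sup>2 * (of_int k ^ 2 + of_int l ^ 2) * cmod (a (k, l))"
      by (simp only: norm_mult norm_of_real) simp
    moreover have "(of_int k ^ 2 + of_int l ^ 2 :: real) \<le> ?h k l ^ 2"
      by (simp add: power2_eq_square algebra_simps)
    ultimately have "cmod (laplacian \<theta> a (k, l)) \<le> (2 * pi)\<^sup>2 * ?h k l ^ 2 * cmod (a (k, l))"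
      by (simp add: mult_left_mono mult_right_mono)
    then have "?h k l ^ N * cmod (laplacian \<theta> a (k, l)) \<le>
        ?h k l ^ N * ((2 * pi)\<^sup>2 * ?h k l ^ 2 * cmod (a (k, l)))"
      by (rule mult_left_mono) simp
    also have "\<dots> = (2 * pi)\<^sup>2 * (?h k l ^ (N + 2) * cmod (a (k, l)))"
      by (simp only: power_add mult_ac)
    also have "\<dots> \<le> (2 * pi)\<^sup>2 * C"
      by (rule mult_left_mono[OF C]) simp
    finally show ?thesis .
  qed
  then show "\<exists>C. \<forall>k l. ?h k l ^ N * cmod (laplacian \<theta> a (k, l)) \<le> C" by blast
qed

lemma smooth_torus_minus:
  assumes "rapidly_decreasing b"
  shows "a \<ominus>\<^bsub>smooth_torus \<theta>\<^esub> b = (\<lambda>x. a x - b x)"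
proof -
  have "rapidly_decreasing (\<lambda>x. - b x)"
    using assms by (simp add: rapidly_decreasing_iff)
  then have "\<ominus>\<^bsub>smooth_torus \<theta>\<^esub> b = (\<lambda>x. - b x)"
    unfolding a_inv_def m_inv_def smooth_torus_def
    by (intro the_equality) (auto simp: fun_eq_iff eq_neg_iff_add_eq_0)
  then show ?thesis
    by (simp add: a_minus_def smooth_torus_def)
qed

text \<open>
  The additive inverse in a ring record is only meaningful on the carrier, so turning the vanishing
  of a difference into an equation of arrays rests on the closure of the smooth torus under products.
\<close>

lemma euler_lagrange_iff:
  assumes "rapidly_decreasing p"
  shows "euler_lagrange \<theta> p \<longleftrightarrow> torus_mult \<theta> p (laplacian \<theta> p) = torus_mult \<theta> (laplacian \<theta> p) p"
proof -
  have "rapidly_decreasing (laplacian \<theta> p \<otimes>\<^bsub>smooth_torus \<theta>\<^esub> p)"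
    using assms by (simp add: smooth_torus_def rapidly_decreasing_mult rapidly_decreasing_laplacian)
  then show ?thesis
    unfolding euler_lagrange_def
    by (subst smooth_torus_minus) (auto simp: smooth_torus_def fun_eq_iff)
qed

lemma euler_lagrange_dual_action:
  assumes "rapidly_decreasing p" "euler_lagrange \<theta> p"
  shows "euler_lagrange \<theta> (dual_action \<alpha> \<beta> p)"
  using assms
  by (simp add: euler_lagrange_iff dual_action_rapidly_decreasing dual_action_laplacian
      dual_action_mult)

section \<open>Conjugation by monomials\<close>

lemma torus_mult_monomial_left:
  "torus_mult \<theta> (\<lambda>x. c * monomial k l x) a (x, y) =
     c * cis (- 2 * pi * \<theta> * of_int (l * (x - k))) * a (x - k, y - l)"
proof -
  have "torus_mult \<theta> (\<lambda>x. c * monomial k l x) a (x, y) =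
     (\<Sum>\<^sub>\<infinity>(i, j)\<in>{(k, l)}. cis (- 2 * pi * \<theta> * of_int (j * (x - i))) *
        (c * monomial k l (i, j)) * a (x - i, y - j))"
    unfolding torus_mult_def prod.case
    by (rule infsum_cong_neutral) (auto simp: monomial_def split: if_splits)
  then show ?thesis by (simp add: monomial_def)
qed

lemma torus_mult_monomial_right:
  "torus_mult \<theta> a (\<lambda>x. c * monomial k l x) (x, y) =
     c * cis (- 2 * pi * \<theta> * of_int ((y - l) * k)) * a (x - k, y - l)"
proof -
  have "torus_mult \<theta> a (\<lambda>x. c * monomial k l x) (x, y) =
     (\<Sum>\<^sub>\<infinity>(i, j)\<in>{(x - k, y - l)}. cis (- 2 * pi * \<theta> * of_int (j * (x - i))) *
        a (i, j) * (c * monomial k l (x - i, y - j)))"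
    unfolding torus_mult_def prod.case
    by (rule infsum_cong_neutral) (auto simp: monomial_def split: if_splits)
  then show ?thesis by (simp add: monomial_def)
qed

lemma Ad_monomial:
  assumes "cmod \<mu> = 1"
  shows "Ad \<theta> (\<mu> \<odot>\<^bsub>smooth_torus \<theta>\<^esub> monomial m n) a =
    dual_action (- 2 * pi * \<theta> * of_int n) (2 * pi * \<theta> * of_int m) a"
proof (rule ext, clarify)
  fix x y :: int
  let ?w = "\<lambda>x. \<mu> * monomial m n x"
  have w: "\<mu> \<odot>\<^bsub>smooth_torus \<theta>\<^esub> monomial m n = ?w"
    by (simp add: smooth_torus_def)
  have star: "torus_star \<theta> ?w =
      (\<lambda>x. cnj \<mu> * cis (- 2 * pi * \<theta> * of_int (m * n)) * monomial (- m) (- n) x)"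
    by (auto simp: torus_star_def monomial_def fun_eq_iff)
  have \<mu>: "\<mu> * (cnj \<mu> * z) = z" for z
    using assms by (simp add: complex_norm_square[symmetric] flip: mult.assoc)
  have "Ad \<theta> ?w a (x, y) =
      \<mu> * (cnj \<mu> * (cis (- 2 * pi * \<theta> * of_int (m * n)) * cis (2 * pi * \<theta> * of_int ((y + n) * m)) *
        cis (- 2 * pi * \<theta> * of_int (n * x)) * a (x, y)))"
  proof -
    have "Ad \<theta> ?w a (x, y) = torus_mult \<theta> (torus_mult \<theta> ?w a) (torus_star \<theta> ?w) (x, y)"
      by (simp add: Ad_def smooth_torus_def)
    then show ?thesis
      unfolding star torus_mult_monomial_right torus_mult_monomial_left by (simp add: mult_ac)
  qed
  also have "\<dots> = dual_action (- 2 * pi * \<theta> * of_int n) (2 * pi * \<theta> * of_int m) a (x, y)"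
    unfolding \<mu> by (simp add: dual_action_def cis_mult cis_mult_left algebra_simps)
  finally show "Ad \<theta> (\<mu> \<odot>\<^bsub>smooth_torus \<theta>\<^esub> monomial m n) a (x, y) =
      dual_action (- 2 * pi * \<theta> * of_int n) (2 * pi * \<theta> * of_int m) a (x, y)"
    unfolding w .
qed

lemma rapidly_decreasing_monomial: "rapidly_decreasing (monomial k l)"
  unfolding rapidly_decreasing_iff
proof
  fix N
  show "\<exists>C. \<forall>i j. (1 + \<bar>of_int i\<bar> + \<bar>of_int j\<bar>) ^ N * cmod (monomial k l (i, j)) \<le> C"
    by (rule exI[of _ "(1 + \<bar>of_int k\<bar> + \<bar>of_int l\<bar>) ^ N"]) (auto simp: monomial_def)
qed

text \<open>
  Multiplication by a monomial shifts an array and changes phases, so a one-sided inverse is already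
  determined coefficient by coefficient. For \<open>kl = 0\<close>, that is for powers of \<open>U\<close> or of \<open>V\<close> alone, no
  phase is left over.
\<close>

lemma torus_inv_monomial:
  assumes "k * l = 0"
  shows "inv\<^bsub>smooth_torus \<theta>\<^esub> (monomial k l) = monomial (- k) (- l)"
  unfolding m_inv_def
proof (rule the_equality)
  show "monomial (- k) (- l) \<in> carrier (smooth_torus \<theta>) \<and>
      monomial k l \<otimes>\<^bsub>smooth_torus \<theta>\<^esub> monomial (- k) (- l) = \<one>\<^bsub>smooth_torus \<theta>\<^esub> \<and>
      monomial (- k) (- l) \<otimes>\<^bsub>smooth_torus \<theta>\<^esub> monomial k l = \<one>\<^bsub>smooth_torus \<theta>\<^esub>"
    unfolding monomial_mult using assms
    by (auto simp: smooth_torus_def rapidly_decreasing_monomial)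
next
  fix y
  assume "y \<in> carrier (smooth_torus \<theta>) \<and>
      monomial k l \<otimes>\<^bsub>smooth_torus \<theta>\<^esub> y = \<one>\<^bsub>smooth_torus \<theta>\<^esub> \<and>
      y \<otimes>\<^bsub>smooth_torus \<theta>\<^esub> monomial k l = \<one>\<^bsub>smooth_torus \<theta>\<^esub>"
  then have y: "torus_mult \<theta> (monomial k l) y = monomial 0 0"
    by (simp add: smooth_torus_def)
  have "y (i, j) = monomial (- k) (- l) (i, j)" for i j
  proof -
    have "cis (- 2 * pi * \<theta> * of_int (l * i)) * y (i, j) = monomial 0 0 (i + k, j + l)"
      using torus_mult_monomial_left[of \<theta> 1 k l y "i + k" "j + l"] y by simp
    then show ?thesis
      using assms by (auto simp: monomial_def add_eq_0_iff split: if_splits)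
  qed
  then show "y = monomial (- k) (- l)" by auto
qed

lemma torus_nat_pow_monomial:
  assumes "k * l = 0"
  shows "monomial k l [^]\<^bsub>smooth_torus \<theta>\<^esub> (n::nat) = monomial (int n * k) (int n * l)"
proof (induction n)
  case 0
  then show ?case by (simp add: nat_pow_def smooth_torus_def)
next
  case (Suc n)
  have "monomial k l [^]\<^bsub>smooth_torus \<theta>\<^esub> Suc n =
      monomial k l [^]\<^bsub>smooth_torus \<theta>\<^esub> n \<otimes>\<^bsub>smooth_torus \<theta>\<^esub> monomial k l"
    by (simp add: nat_pow_def)
  also have "\<dots> = monomial (int (Suc n) * k) (int (Suc n) * l)"
    unfolding Suc monomial_mult using assms by (auto simp: smooth_torus_def algebra_simps)
  finally show ?case .
qed

lemma torus_int_pow_monomial: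
  assumes "k * l = 0"
  shows "monomial k l [^]\<^bsub>smooth_torus \<theta>\<^esub> (n::int) = monomial (n * k) (n * l)"
proof (cases "n < 0")
  case True
  then have n: "int (nat (- n)) = - n" by simp
  have "- n * k * (- n * l) = 0" using assms by auto
  then have "inv\<^bsub>smooth_torus \<theta>\<^esub> (monomial (- n * k) (- n * l)) = monomial (n * k) (n * l)"
    by (subst torus_inv_monomial) auto
  then show ?thesis
    unfolding int_pow_def2 torus_nat_pow_monomial[OF assms] n using True by simp
next
  case False
  then have n: "int (nat n) = n" by simp
  show ?thesis
    unfolding int_pow_def2 torus_nat_pow_monomial[OF assms] n using False by simp
qed

lemma torus_U_pow_V_pow:
  "torus_U [^]\<^bsub>smooth_torus \<theta>\<^esub> (m::int) \<otimes>\<^bsub>smooth_torus \<theta>\<^esub> torus_V [^]\<^bsub>smooth_torus \<theta>\<^esub> (n::int)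
    = monomial m n"
  by (simp add: torus_int_pow_monomial monomial_mult) (simp add: smooth_torus_def)

section \<open>Schwartz functions\<close>

lemma bounded_range_add:
  fixes f g :: "real \<Rightarrow> complex"
  assumes "bounded (range f)" "bounded (range g)"
  shows "bounded (range (\<lambda>t. f t + g t))"
  using bounded_plus_comp[of f UNIV g] assms by simp

lemma bounded_range_cmult:
  fixes f :: "real \<Rightarrow> complex"
  assumes "bounded (range f)"
  shows "bounded (range (\<lambda>t. c * f t))"
  using assms bounded_linear_image[OF _ bounded_linear_mult_right, of "range f" c]
  by (simp add: image_image)

lemma schwartzI:
  assumes "D 0 = f" "\<And>j t. (D j has_vector_derivative D (Suc j) t) (at t)"
    "\<And>j k. bounded (range (\<lambda>t. of_real t ^ k * D j t))"
  shows "f \<in> schwartz"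
  unfolding schwartz_def mem_Collect_eq using assms by (intro exI[of _ D] conjI allI)

lemma schwartzE:
  assumes "f \<in> schwartz"
  obtains D where "D 0 = f" "\<forall>j t. (D j has_vector_derivative D (Suc j) t) (at t)"
    "\<forall>j k. bounded (range (\<lambda>t. of_real t ^ k * D j t))"
  using assms unfolding schwartz_def mem_Collect_eq by (elim exE conjE) (rule that)

lemma schwartz_translate:
  assumes "f \<in> schwartz"
  shows "(\<lambda>t. f (t + s)) \<in> schwartz"
proof -
  obtain D where D0: "D 0 = f" and D_all: "\<forall>j t. (D j has_vector_derivative D (Suc j) t) (at t)"
      "\<forall>j k. bounded (range (\<lambda>t. of_real t ^ k * D j t))"
    using assms by (rule schwartzE)
  note D = D_all[rule_format]
  \<comment> \<open>One factor \<open>t - s\<close> is expanded at a time; the spare power \<open>t ^ i\<close> absorbs what this produces.\<close>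
  have P: "bounded (range (\<lambda>t. of_real (t - s) ^ k * (of_real t ^ i * D j t)))" for k i j
  proof (induction k arbitrary: i)
    case 0
    then show ?case using D(2)[of i j] by simp
  next
    case (Suc k)
    show ?case
      using bounded_range_add[OF Suc[of "Suc i"] bounded_range_cmult[OF Suc[of i], of "- of_real s"]]
      by (simp add: algebra_simps)
  qed
  have "bounded (range (\<lambda>t. of_real t ^ k * D j (t + s)))" for k j
  proof (rule bounded_subset[OF P[of k 0 j]], clarify)
    fix t
    show "of_real t ^ k * D j (t + s) \<in> range (\<lambda>t. of_real (t - s) ^ k * (of_real t ^ 0 * D j t))"
      by (rule range_eqI[of _ _ "t + s"]) simp
  qed
  moreover have "((\<lambda>t. D j (t + s)) has_vector_derivative D (Suc j) (t + s)) (at t)" for j t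
  proof -
    have "((\<lambda>t. t + s) has_vector_derivative 1) (at t)"
      by (auto intro!: derivative_eq_intros)
    from vector_diff_chain_at[OF this D(1)[of j "t + s"]] show ?thesis
      by (simp add: o_def)
  qed
  ultimately show ?thesis
    using D0 by (intro schwartzI[of "\<lambda>j t. D j (t + s)"]) auto
qed

text \<open>
  If \<open>D i\<close> is the \<open>i\<close>-th derivative of \<open>f\<close>, then \<open>e\<^bsup>\<alpha>t\<^esup>\<close> times \<open>modulated_derivs \<alpha> D j i\<close> is the \<open>j\<close>-th
  derivative of \<open>e\<^bsup>\<alpha>t\<^esup> D i\<close>. The recursion applies the operator \<open>\<alpha> + d/dt\<close> instead of expanding its
  power by Leibniz' rule, so no binomial coefficients appear.
\<close>

primrec modulated_derivs ::
  "complex \<Rightarrow> (nat \<Rightarrow> real \<Rightarrow> complex) \<Rightarrow> nat \<Rightarrow> nat \<Rightarrow> real \<Rightarrow> complex" where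
  "modulated_derivs \<alpha> D 0 i = D i"
| "modulated_derivs \<alpha> D (Suc j) i =
     (\<lambda>t. \<alpha> * modulated_derivs \<alpha> D j i t + modulated_derivs \<alpha> D j (Suc i) t)"

lemma schwartz_modulate:
  assumes "f \<in> schwartz"
  shows "(\<lambda>t. cis (a * t + b) * f t) \<in> schwartz"
proof -
  obtain D where D0: "D 0 = f" and D_all: "\<forall>j t. (D j has_vector_derivative D (Suc j) t) (at t)"
      "\<forall>j k. bounded (range (\<lambda>t. of_real t ^ k * D j t))"
    using assms by (rule schwartzE)
  note D = D_all[rule_format]
  let ?E = "modulated_derivs (\<i> * of_real a) D"
  have E_deriv: "(?E j i has_vector_derivative ?E j (Suc i) t) (at t)" for i j t
    by (induction j arbitrary: i) (auto intro!: derivative_eq_intros D(1))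
  have E_bdd: "bounded (range (\<lambda>t. of_real t ^ k * ?E j i t))" for i j k
  proof (induction j arbitrary: i)
    case 0
    show ?case using D(2) by simp
  next
    case (Suc j)
    show ?case
      using bounded_range_add[OF bounded_range_cmult[OF Suc[of i], of "\<i> * of_real a"] Suc[of "Suc i"]]
      by (simp add: algebra_simps)
  qed
  have cis_deriv: "((\<lambda>t. cis (a * t + b)) has_vector_derivative \<i> * of_real a * cis (a * t + b)) (at t)"
    for t
  proof -
    have "((\<lambda>z. exp (\<i> * (of_real a * z + of_real b))) has_field_derivative
        \<i> * of_real a * exp (\<i> * (of_real a * of_real t + of_real b))) (at (of_real t))"
      by (auto intro!: derivative_eq_intros)
    from has_vector_derivative_real_field[OF this] show ?thesis
      by (simp add: cis_conv_exp)
  qed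
  have deriv: "((\<lambda>t. cis (a * t + b) * ?E j 0 t) has_vector_derivative
      cis (a * t + b) * ?E (Suc j) 0 t) (at t)" for j t
    by (rule derivative_eq_intros cis_deriv E_deriv refl)+ (simp add: algebra_simps)
  have bdd: "bounded (range (\<lambda>t. of_real t ^ k * (cis (a * t + b) * ?E j 0 t)))" for j k
    using E_bdd[of k j 0] by (simp add: bounded_iff norm_mult)
  show ?thesis
    using D0 by (intro schwartzI[of "\<lambda>j t. cis (a * t + b) * ?E j 0 t"] deriv bdd) auto
qed

lemma schwartz_left_monomial:
  assumes "\<xi> \<in> schwartz"
  shows "left_monomial \<theta> m n \<xi> \<in> schwartz"
proof -
  have "left_monomial \<theta> m n \<xi> =
    (\<lambda>t. cis (2 * pi * \<theta> * of_int n * t + 2 * pi * \<theta> * of_int n * of_int m) * \<xi> (t + of_int m))"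
    by (simp add: left_monomial_def algebra_simps)
  then show ?thesis
    using schwartz_modulate[OF schwartz_translate[OF assms]] by simp
qed

section \<open>Monomials acting on the bimodule\<close>

text \<open>
  Translating the Gaussian by \<open>m\<close> produces the linear term \<open>-2\<pi>\<theta>mt\<close> in the exponent, and \<open>V\<^sup>n\<close> contributes
  \<open>2\<pi>i\<theta>nt\<close>. Both are absorbed into \<open>-2izt\<close> by moving \<open>z\<close> by \<open>-\<pi>\<theta>(n + im)\<close>; the remaining
  terms are constant.
\<close>

lemma left_monomial_gaussian:
  "\<exists>C' z'. left_monomial \<theta> m n (gaussian \<theta> C z) = gaussian \<theta> C' z'"
proof (intro exI ext)
  fix t
  show "left_monomial \<theta> m n (gaussian \<theta> C z) t =
    gaussian \<theta> (C * exp (- of_real (pi * \<theta> * (of_int m)\<^sup>2) - 2 * \<i> * z * of_int m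
        + \<i> * of_real (2 * pi * \<theta> * of_int n * of_int m)))
      (z - \<i> * of_real (pi * \<theta> * of_int m) - of_real (pi * \<theta> * of_int n)) t"
    unfolding left_monomial_def gaussian_def cis_conv_exp mult.assoc mult.left_commute[of "exp _" C]
      exp_add[symmetric]
    by (simp add: algebra_simps power2_eq_square)
qed

lemma lborel_integral_translate:
  fixes f :: "real \<Rightarrow> complex"
  shows "(\<integral>t. f (t + s) \<partial>lborel) = (\<integral>t. f t \<partial>lborel)"
  using lborel_integral_real_affine[of 1 f s] by (simp add: add.commute)

text \<open>
  The left action translates by \<open>\<int>\<close> and modulates with frequencies in \<open>\<theta>\<int>\<close>, the right one translates
  by \<open>\<theta>\<^sup>-\<^sup>1\<int>\<close> and modulates with frequencies in \<open>\<int>\<close>: the frequencies of each are dual to the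
  translations of the other. Exchanging them costs the phases \<open>e\<^bsup>2\<pi>ink\<^esup>\<close> and \<open>e\<^bsup>2\<pi>ilm\<^esup>\<close>, both equal to 1.
\<close>

lemma right_monomial_left_monomial:
  assumes "\<theta> \<noteq> 0"
  shows "right_monomial \<theta> (left_monomial \<theta> m n \<xi>) k l = left_monomial \<theta> m n (right_monomial \<theta> \<xi> k l)"
proof
  fix t
  have 1: "cis (2 * pi * of_int n * of_int k) = 1"  "cis (2 * pi * of_int l * of_int m) = 1"
    using cis_of_int_turns[of "n * k"] cis_of_int_turns[of "l * m"] by (simp_all add: mult.assoc)
  have "right_monomial \<theta> (left_monomial \<theta> m n \<xi>) k l t =
      cis (2 * pi * of_int l * t) * cis (2 * pi * \<theta> * of_int n * (t + of_int m)) *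
        cis (2 * pi * of_int n * of_int k) * \<xi> (t + of_int m + of_int k / \<theta>)"
  proof -
    have "2 * pi * \<theta> * of_int n * (t + of_int k / \<theta> + of_int m) =
        2 * pi * \<theta> * of_int n * (t + of_int m) + 2 * pi * of_int n * of_int k"
      using assms by (simp add: distrib_left)
    then show ?thesis
      unfolding right_monomial_def left_monomial_def by (simp add: cis_mult add_ac mult.assoc[symmetric])
  qed
  moreover have "left_monomial \<theta> m n (right_monomial \<theta> \<xi> k l) t =
      cis (2 * pi * of_int l * t) * cis (2 * pi * \<theta> * of_int n * (t + of_int m)) *
        cis (2 * pi * of_int l * of_int m) * \<xi> (t + of_int m + of_int k / \<theta>)"
    by (simp add: right_monomial_def left_monomial_def cis_mult algebra_simps)
  ultimately show "right_monomial \<theta> (left_monomial \<theta> m n \<xi>) k l t =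
      left_monomial \<theta> m n (right_monomial \<theta> \<xi> k l) t"
    by (simp add: 1)
qed

lemma right_act_left_monomial:
  assumes "\<theta> \<noteq> 0"
  shows "right_act \<theta> (left_monomial \<theta> m n \<xi>) b = left_monomial \<theta> m n (right_act \<theta> \<xi> b)"
proof
  fix t
  let ?c = "cis (2 * pi * \<theta> * of_int n * (t + of_int m))"
  have "right_act \<theta> (left_monomial \<theta> m n \<xi>) b t =
      (\<Sum>\<^sub>\<infinity>(k, l). ?c * (b (k, l) * right_monomial \<theta> \<xi> k l (t + of_int m)))"
    unfolding right_act_def right_monomial_left_monomial[OF assms]
    by (simp add: left_monomial_def mult_ac)
  also have "\<dots> = left_monomial \<theta> m n (right_act \<theta> \<xi> b) t"
    by (simp add: right_act_def left_monomial_def case_prod_unfold infsum_cmult_right')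
  finally show "right_act \<theta> (left_monomial \<theta> m n \<xi>) b t = left_monomial \<theta> m n (right_act \<theta> \<xi> b) t" .
qed

lemma left_monomial_unitary:
  "(\<integral>t. cnj (left_monomial \<theta> m n \<xi> t) * left_monomial \<theta> m n \<eta> t \<partial>lborel) = (\<integral>t. cnj (\<xi> t) * \<eta> t \<partial>lborel)"
proof -
  have "cnj (left_monomial \<theta> m n \<xi> t) * left_monomial \<theta> m n \<eta> t =
      cnj (\<xi> (t + of_int m)) * \<eta> (t + of_int m)" for t
    by (simp add: left_monomial_def cis_cnj cis_mult cis_mult_left mult_ac)
  then show ?thesis
    using lborel_integral_translate[of "\<lambda>t. cnj (\<xi> t) * \<eta> t" "of_int m"] by simp
qed

lemma B_inner_left_monomial:
  assumes "\<theta> \<noteq> 0"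
  shows "B_inner \<theta> (left_monomial \<theta> m n \<xi>) (left_monomial \<theta> m n \<eta>) = B_inner \<theta> \<xi> \<eta>"
  unfolding B_inner_def right_monomial_left_monomial[OF assms] left_monomial_unitary ..

lemma left_monomial_commute:
  "left_monomial \<theta> k l (left_monomial \<theta> m n \<xi>) t =
     cis (2 * pi * \<theta> * of_int (n * k - m * l)) * left_monomial \<theta> m n (left_monomial \<theta> k l \<xi>) t"
  by (simp add: left_monomial_def cis_mult cis_mult_left algebra_simps)

text \<open>
  Moving the monomial \<open>U\<^sup>kV\<^sup>l\<close> past \<open>U\<^sup>mV\<^sup>n\<close> costs the commutation phase, which is the eigenvalue of
  \<open>Ad(U\<^sup>mV\<^sup>n)\<close> on \<open>U\<^sup>kV\<^sup>l\<close>; the unitary \<open>U\<^sup>mV\<^sup>n\<close> then disappears from the integral.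
\<close>

lemma A_inner_left_monomial:
  "A_inner \<theta> (left_monomial \<theta> m n \<xi>) (left_monomial \<theta> m n \<eta>) =
     dual_action (- 2 * pi * \<theta> * of_int n) (2 * pi * \<theta> * of_int m) (A_inner \<theta> \<xi> \<eta>)"
proof (rule ext, clarify)
  fix k l
  let ?c = "cis (2 * pi * \<theta> * of_int (m * l - n * k))"
  let ?L = "left_monomial \<theta> m n"
  have "(\<integral>t. ?L \<xi> t * cnj (left_monomial \<theta> k l (?L \<eta>) t) \<partial>lborel) =
      (\<integral>t. ?c * (cnj (?L (left_monomial \<theta> k l \<eta>) t) * ?L \<xi> t) \<partial>lborel)"
    unfolding left_monomial_commute[of \<theta> k l]
    by (intro Bochner_Integration.integral_cong) (auto simp: cis_cnj algebra_simps)
  also have "\<dots> = ?c * (\<integral>t. cnj (left_monomial \<theta> k l \<eta> t) * \<xi> t \<partial>lborel)"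
    by (simp add: left_monomial_unitary)
  finally show "A_inner \<theta> (?L \<xi>) (?L \<eta>) (k, l) =
      dual_action (- 2 * pi * \<theta> * of_int n) (2 * pi * \<theta> * of_int m) (A_inner \<theta> \<xi> \<eta>) (k, l)"
    by (simp add: A_inner_def dual_action_def algebra_simps)
qed

section \<open>Conjugates of instanton solutions\<close>

theorem theorem3p3:
  fixes \<theta> :: real and m n :: int and \<mu> :: complex and w p :: "int \<times> int \<Rightarrow> complex"
  assumes "\<theta> \<notin> \<rat>"
    and "cmod \<mu> = 1"
    and "w = \<mu> \<odot>\<^bsub>smooth_torus \<theta>\<^esub> (torus_U [^]\<^bsub>smooth_torus \<theta>\<^esub> m \<otimes>\<^bsub>smooth_torus \<theta>\<^esub> torus_V [^]\<^bsub>smooth_torus \<theta>\<^esub> n)"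
    and "instanton_solution \<theta> p" and "euler_lagrange \<theta> p"
  shows "instanton_solution \<theta> (Ad \<theta> w p) \<and> euler_lagrange \<theta> (Ad \<theta> w p)"
proof -
  have \<theta>: "\<theta> \<noteq> 0" using assms(1) by auto
  have Ad: "Ad \<theta> w p = dual_action (- 2 * pi * \<theta> * of_int n) (2 * pi * \<theta> * of_int m) p"
    unfolding assms(3) torus_U_pow_V_pow by (rule Ad_monomial[OF assms(2)])
  have proj: "torus_projection \<theta> p"
    using assms(4) unfolding instanton_solution_def by blast
  then have "rapidly_decreasing p"
    by (simp add: torus_projection_def smooth_torus_def)
  then have "euler_lagrange \<theta> (Ad \<theta> w p)"
    unfolding Ad using assms(5) by (rule euler_lagrange_dual_action)
  moreover have "instanton_solution \<theta> (Ad \<theta> w p)"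
  proof -
    let ?B = "smooth_torus (- 1 / \<theta>)"
    obtain C z where \<xi>: "gaussian \<theta> C z \<in> schwartz"
      "B_inner \<theta> (gaussian \<theta> C z) (gaussian \<theta> C z) \<in> Units ?B"
      "p = A_inner \<theta> (right_act \<theta> (gaussian \<theta> C z)
        (inv\<^bsub>?B\<^esub> (B_inner \<theta> (gaussian \<theta> C z) (gaussian \<theta> C z)))) (gaussian \<theta> C z)"
      using assms(4) unfolding instanton_solution_def Let_def by blast
    obtain C' z' where g: "gaussian \<theta> C' z' = left_monomial \<theta> m n (gaussian \<theta> C z)"
      using left_monomial_gaussian by metis
    show ?thesis
      unfolding instanton_solution_def Let_def
    proof (intro conjI exI)
      show "torus_projection \<theta> (Ad \<theta> w p)"
        unfolding Ad by (rule torus_projection_dual_action[OF proj])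
      show "gaussian \<theta> C' z' \<in> schwartz"
        unfolding g by (rule schwartz_left_monomial[OF \<xi>(1)])
      show "B_inner \<theta> (gaussian \<theta> C' z') (gaussian \<theta> C' z') \<in> Units ?B"
        unfolding g B_inner_left_monomial[OF \<theta>] by (rule \<xi>(2))
      show "Ad \<theta> w p = A_inner \<theta> (right_act \<theta> (gaussian \<theta> C' z')
          (inv\<^bsub>?B\<^esub> (B_inner \<theta> (gaussian \<theta> C' z') (gaussian \<theta> C' z')))) (gaussian \<theta> C' z')"
        unfolding g Ad B_inner_left_monomial[OF \<theta>] right_act_left_monomial[OF \<theta>]
          A_inner_left_monomial by (subst \<xi>(3)) (rule refl)
    qed
  qed
  ultimately show ?thesis by blast
qed

end
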